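(* Let $\mu,\nu\in\mathrm{M}_0(\mathbb{R}^d)$ and assume that for every $y\in\mathrm{spt}\,\nu\setminus\{0\}$ there exists $x\in\mathrm{spt}\,\mu$ such that $\langle x,y\rangle>0$. Then $\gamma\in\Gamma_{0,\mathrm{m}}(\mu,\nu)$ is proper as soon as its support is homogeneous in the sense that there exist $\alpha,\beta>0$ such that for all $\lambda>0$, $$(x,y)\in\mathrm{spt}\,\gamma\implies(\lambda^\alpha x,\lambda^\beta y)\in\mathrm{spt}\,\gamma.$$
   Context: $\mathrm{M}_0(\mathbb{R}^k)$ denotes the set of nonnegative Borel measures $\mu$ on $\mathbb{R}^k\setminus\{0\}$ such that $\mu(B)<\infty$ for every Borel set $B\subset\mathbb{R}^k\setminus\{0\}$ with $0\notin \mathrm{cl}(B)$ (closure in $\mathbb{R}^k$). The support $\mathrm{spt}\,\mu$ is the set of $x\in\mathbb{R}^k$ such that $\mu(U\setminus\{0\})>0$ for every open $U\subset\mathbb{R}^k$ containing $x$ (so $0$ may belong to $\mathrm{spt}\,\mu$). For $\mu,\nu\in\mathrm{M}_0(\mathbb{R}^d)$, a zero-coupling between $\mu$ and $\nu$ is a nonnegative Borel measure $\gamma$ on $(\mathbb{R}^d\times\mathbb{R}^d)\setminus\{(0,0)\}$ such that $\gamma(A\times\mathbb{R}^d)=\mu(A)$ and $\gamma(\mathbb{R}^d\times A)=\nu(A)$ for all Borel $A\subset\mathbb{R}^d\setminus\{0\}$; any such $\gamma$ belongs to $\mathrm{M}_0(\mathbb{R}^d\times\mathbb{R}^d)=\mathrm{M}_0(\mathbb{R}^{2d})$.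 $\Gamma_{0,\mathrm{m}}(\mu,\nu)$ is the set of zero-couplings $\gamma$ between $\mu$ and $\nu$ whose support is monotone, i.e. $\langle x_1-x_2,y_1-y_2\rangle\ge0$ for all $(x_1,y_1),(x_2,y_2)\in\mathrm{spt}\,\gamma$. A zero-coupling $\gamma$ is proper if $\gamma(\{0\}\times(\mathbb{R}^d\setminus\{0\}))=0$. *)

theory Defs
  imports "HOL-Analysis.Analysis"
begin

text \<open>
  The ambient space is an arbitrary Euclidean space \<open>'a\<close>, so that the same notions apply to
  \<open>\<real>\<^sup>d\<close> and to the product \<open>\<real>\<^sup>d \<times> \<real>\<^sup>d\<close>, whose origin \<open>0\<close> is \<open>(0, 0)\<close>.
  The sigma-algebra condition forces \<open>space \<mu> = - {0}\<close>.
\<close>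

definition punctured_borel_measure :: "'a::euclidean_space measure \<Rightarrow> bool" where
  "punctured_borel_measure \<mu> \<longleftrightarrow> sets \<mu> = sets (restrict_space borel (- {0}))"

definition M0 :: "'a::euclidean_space measure set" where
  "M0 = {\<mu>. punctured_borel_measure \<mu> \<and>
            (\<forall>B\<in>sets \<mu>. 0 \<notin> closure B \<longrightarrow> emeasure \<mu> B < \<infinity>)}"

text \<open>The origin may belong to the support although it is not a point of the underlying space.\<close>

definition spt :: "'a::euclidean_space measure \<Rightarrow> 'a set" where
  "spt \<mu> = {x. \<forall>U. open U \<longrightarrow> x \<in> U \<longrightarrow> emeasure \<mu> (U - {0}) > 0}"

definition zero_coupling ::
  "'a::euclidean_space measure \<Rightarrow> 'a measure \<Rightarrow> ('a \<times> 'a) measure \<Rightarrow> bool" where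
  "zero_coupling \<mu> \<nu> \<gamma> \<longleftrightarrow>
     punctured_borel_measure \<gamma> \<and>
     (\<forall>A. A \<in> sets borel \<longrightarrow> A \<subseteq> - {0} \<longrightarrow>
        emeasure \<gamma> (A \<times> UNIV) = emeasure \<mu> A \<and>
        emeasure \<gamma> (UNIV \<times> A) = emeasure \<nu> A)"

definition monotone_set :: "('a::real_inner \<times> 'a) set \<Rightarrow> bool" where
  "monotone_set S \<longleftrightarrow>
     (\<forall>(x1, y1)\<in>S. \<forall>(x2, y2)\<in>S. inner (x1 - x2) (y1 - y2) \<ge> 0)"

definition monotone_zero_couplings ::
  "'a::euclidean_space measure \<Rightarrow> 'a measure \<Rightarrow> ('a \<times> 'a) measure set" where
  "monotone_zero_couplings \<mu> \<nu> = {\<gamma>. zero_coupling \<mu> \<nu> \<gamma> \<and> monotone_set (spt \<gamma>)}"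

definition proper_coupling :: "('a::euclidean_space \<times> 'a) measure \<Rightarrow> bool" where
  "proper_coupling \<gamma> \<longleftrightarrow> emeasure \<gamma> ({0} \<times> (- {0})) = 0"

definition homogeneous_set :: "('a::real_vector \<times> 'a) set \<Rightarrow> bool" where
  "homogeneous_set S \<longleftrightarrow>
     (\<exists>\<alpha> \<beta> :: real. \<alpha> > 0 \<and> \<beta> > 0 \<and>
        (\<forall>l::real. l > 0 \<longrightarrow>
           (\<forall>x y. (x, y) \<in> S \<longrightarrow> ((l powr \<alpha>) *\<^sub>R x, (l powr \<beta>) *\<^sub>R y) \<in> S)))"

end

theory Submission
  imports Defs
begin

text \<open>
  A measure on the punctured space can charge a set only if its support meets that set, because
  the complement of the support is a countable union of open null sets. If \<open>\<gamma>\<close> were not proper, it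
  would therefore have a support point \<open>(0, y)\<close> with \<open>y \<noteq> 0\<close>; projecting, \<open>y\<close> lies in the support
  of \<open>\<nu>\<close>, so the support of \<open>\<mu>\<close> reaches into the open half-space of all \<open>x\<close> with
  \<open>inner x y > 0\<close>. Then \<open>\<gamma>\<close> charges the part of the product lying over this half-space, and its
  support contains some \<open>(x', y')\<close> with \<open>inner x' y > 0\<close>.

  Homogeneity acts on the point \<open>(0, y)\<close> by stretching it: the whole ray of points \<open>(0, t *\<^sub>R y)\<close>,
  \<open>t > 0\<close>, lies in the support. Monotonicity between \<open>(x', y')\<close> and these points reads
  \<open>t * inner x' y \<le> inner x' y'\<close> for all \<open>t > 0\<close>, which fails for large \<open>t\<close>.
\<close>

lemma punctured_borel_measure_sets:
  assumes "punctured_borel_measure \<mu>" and "B \<in> sets borel" and "0 \<notin> B"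
  shows "B \<in> sets \<mu>"
  using assms by (auto simp: punctured_borel_measure_def sets_restrict_space_iff)

text \<open>
  Each point outside the support has an open neighbourhood that is null off the origin; by the
  Lindelof property countably many of these already cover a set that misses the support.
\<close>

lemma emeasure_pos_imp_meets_spt:
  assumes \<mu>: "punctured_borel_measure \<mu>" and B: "B \<in> sets borel" "0 \<notin> B"
    and pos: "emeasure \<mu> B > 0"
  shows "\<exists>z\<in>B. z \<in> spt \<mu>"
proof (rule ccontr)
  assume neg: "\<not> (\<exists>z\<in>B. z \<in> spt \<mu>)"
  define \<F> where "\<F> = {U. open U \<and> emeasure \<mu> (U - {0}) = 0}"
  have cover: "B \<subseteq> \<Union>\<F>"
    using neg by (fastforce simp: \<F>_def spt_def)
  obtain \<F>' where \<F>': "\<F>' \<subseteq> \<F>" "countable \<F>'" "\<Union>\<F>' = \<Union>\<F>"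
    using Lindelof[of \<F>] by (auto simp: \<F>_def)
  have null: "U - {0} \<in> null_sets \<mu>" if "U \<in> \<F>'" for U
    using that \<F>'(1) punctured_borel_measure_sets[OF \<mu>, of "U - {0}"]
    by (auto simp: \<F>_def null_sets_def)
  have "(\<Union>U\<in>\<F>'. U - {0}) \<in> null_sets \<mu>"
    by (intro null_sets_UN' \<F>'(2) null)
  moreover have "B \<subseteq> (\<Union>U\<in>\<F>'. U - {0})"
    using cover \<F>'(3) B(2) by blast
  ultimately have "B \<in> null_sets \<mu>"
    using null_sets_subset punctured_borel_measure_sets[OF \<mu> B] by blast
  then show False
    using pos by auto
qed

lemma open_pos_emeasure_of_spt:
  assumes "z \<in> spt \<mu>" and "open U" and "z \<in> U" and "0 \<notin> U"
  shows "emeasure \<mu> U > 0"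
  using assms by (fastforce simp: spt_def)

text \<open>
  The point \<open>y\<close> must be nonzero: away from it, the strip over a small neighbourhood of \<open>y\<close> avoids
  the origin, and the marginal condition only speaks about such strips.
\<close>

lemma zero_coupling_snd_spt:
  assumes \<gamma>: "zero_coupling \<mu> \<nu> \<gamma>" and xy: "(x, y) \<in> spt \<gamma>" and "y \<noteq> 0"
  shows "y \<in> spt \<nu>"
  unfolding spt_def
proof (intro CollectI allI impI)
  fix U :: "'a set"
  assume U: "open U" "y \<in> U"
  have "emeasure \<gamma> (UNIV \<times> (U - {0})) > 0"
    using xy U \<open>y \<noteq> 0\<close>
    by (intro open_pos_emeasure_of_spt[OF xy]) (auto simp: zero_prod_def intro!: open_Times)
  moreover have "emeasure \<gamma> (UNIV \<times> (U - {0})) = emeasure \<nu> (U - {0})"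
    using \<gamma> U by (auto simp: zero_coupling_def)
  ultimately show "emeasure \<nu> (U - {0}) > 0"
    by simp
qed

text \<open>
  The support of the first marginal lies in the closure of the projected support of the coupling.
  A point of it need not be the projection of a support point, since the second coordinates of
  nearby support points may escape to infinity.
\<close>

lemma zero_coupling_fst_spt_approx:
  assumes \<gamma>: "zero_coupling \<mu> \<nu> \<gamma>" and x: "x \<in> spt \<mu>"
    and U: "open U" "x \<in> U" "0 \<notin> U"
  obtains x' y' where "x' \<in> U" and "(x', y') \<in> spt \<gamma>"
proof -
  have "emeasure \<mu> U > 0"
    using x U by (rule open_pos_emeasure_of_spt)
  moreover have "emeasure \<gamma> (U \<times> UNIV) = emeasure \<mu> U"
    using \<gamma> U by (auto simp: zero_coupling_def)
  ultimately have "\<exists>z\<in>U \<times> UNIV. z \<in> spt \<gamma>"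
    using \<gamma> U
    by (intro emeasure_pos_imp_meets_spt)
       (auto simp: zero_coupling_def zero_prod_def intro!: borel_open open_Times)
  then show thesis
    using that by blast
qed

theorem proposition3p4:
  fixes \<mu> \<nu> :: "(real ^ 'n) measure"
    and \<gamma> :: "((real ^ 'n) \<times> (real ^ 'n)) measure"
  assumes "\<mu> \<in> M0" and "\<nu> \<in> M0"
    and "\<forall>y\<in>spt \<nu> - {0}. \<exists>x\<in>spt \<mu>. inner x y > 0"
    and "\<gamma> \<in> monotone_zero_couplings \<mu> \<nu>"
    and "homogeneous_set (spt \<gamma>)"
  shows "proper_coupling \<gamma>"
proof (rule ccontr)
  assume "\<not> proper_coupling \<gamma>"
  then have pos: "emeasure \<gamma> ({0} \<times> (- {0})) > 0"
    by (simp add: proper_coupling_def zero_less_iff_neq_zero)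
  have \<gamma>: "zero_coupling \<mu> \<nu> \<gamma>" and mono: "monotone_set (spt \<gamma>)"
    using assms(4) by (auto simp: monotone_zero_couplings_def)
  have "{0} \<times> (- {0}) \<in> sets (borel :: ((real ^ 'n) \<times> (real ^ 'n)) measure)"
    by (intro borel_Times) auto
  then obtain y where y: "(0, y) \<in> spt \<gamma>" "y \<noteq> 0"
    using emeasure_pos_imp_meets_spt[OF _ _ _ pos] \<gamma>
    by (auto simp: zero_coupling_def zero_prod_def)
  obtain x where x: "x \<in> spt \<mu>" "inner x y > 0"
    using assms(3) zero_coupling_snd_spt[OF \<gamma> y] y(2) by blast
  have "open {x. inner x y > 0}"
    by (intro open_Collect_less continuous_intros)
  then obtain x' y' where x': "inner x' y > 0" "(x', y') \<in> spt \<gamma>"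
    using zero_coupling_fst_spt_approx[OF \<gamma> x(1), of "{x. inner x y > 0}"] x(2) by auto
  obtain \<alpha> \<beta> :: real where "\<beta> > 0"
    and hom: "\<And>l x y. l > 0 \<Longrightarrow> (x, y) \<in> spt \<gamma> \<Longrightarrow> ((l powr \<alpha>) *\<^sub>R x, (l powr \<beta>) *\<^sub>R y) \<in> spt \<gamma>"
    using assms(5) unfolding homogeneous_set_def by blast
  have bound: "t * inner x' y \<le> inner x' y'" if "t > 0" for t
  proof -
    \<comment> \<open>The scaling factor \<open>t powr (1 / \<beta>)\<close> moves the second coordinate by exactly \<open>t\<close>.\<close>
    have "(0, t *\<^sub>R y) \<in> spt \<gamma>"
      using hom[of "t powr (1 / \<beta>)", OF _ y(1)] \<open>\<beta> > 0\<close> that by (simp add: powr_powr)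
    then have "inner (x' - 0) (y' - t *\<^sub>R y) \<ge> 0"
      using mono x'(2) unfolding monotone_set_def by blast
    then show ?thesis
      by (simp add: inner_diff_right)
  qed
  \<comment> \<open>The absolute value only serves to make \<open>t\<close> positive.\<close>
  have "(\<bar>inner x' y'\<bar> + 1) / inner x' y * inner x' y \<le> inner x' y'"
    using x'(1) by (intro bound divide_pos_pos) auto
  then show False
    using x'(1) by simp
qed

end
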